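(* Let $X$ be a complete metric space and let $K:X\times X\to\mathbb{R}$ be a continuous admissible kernel that induces the native space $H$ of continuous real-valued functions over $X$. Let $0\le s\le t$, let $\mathbb{T}:=[s,t]$, let $\nu$ be a finite Borel measure on $\mathbb{T}$, and let $\phi\in C([0,t],X)$ be a trajectory. Let $T_\phi(s,t):H\to H$ be the operator defined by $$T_\phi(s,t)g:=\int_s^t E_{\phi(\tau)}^*E_{\phi(\tau)}\,g\;\nu(d\tau),\qquad g\in H.$$ Then $T_\phi(s,t)$ is an integral operator: for all $g\in H$ and $\xi\in X$, $$(T_\phi(s,t)g)(\xi)=\int_s^t K(\xi,\phi(\tau))\,\langle K_{\phi(\tau)},g\rangle_H\,\nu(d\tau)=\int_s^t K(\xi,\phi(\tau))\,g(\phi(\tau))\,\nu(d\tau).$$ If, in addition, there is a constant $\bar K>0$ such that $\sqrt{K(x,x)}\le\bar K$ for all $x\in X$, then: (i) the operator-valued map $\tau\mapsto K_{\phi(\tau)}\otimes K_{\phi(\tau)}\in\mathcal{L}(H)$ is continuous from $\mathbb{T}$ to $\mathcal{L}(H)$ (operator norm) and measurable as a map from $(\mathbb{T},\mathcal{B}_{\mathbb{T}})$ into $(\mathcal{L}(H),\mathcal{B}_{\mathcal{L}(H)})$; (ii) the operator $T_\phi(s,t)$ is given by the Bochner integral in $\mathcal{L}(H)$ $$T_\phi(s,t)=\int_{\mathbb{T}}K_{\phi(\tau)}\otimes K_{\phi(\tau)}\,\nu(d\tau)=\int_{\mathbb{T}}E_{\phi(\tau)}^*E_{\phi(\tau)}\,\nu(d\tau);$$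 (iii) the operator $T_\phi(s,t)$ is compact, self-adjoint, positive, and trace class.
   Context: An admissible kernel is a symmetric, nonnegative (i.e. positive semidefinite) function $K:X\times X\to\mathbb{R}$. For $x\in X$ write $K_x:=K(x,\cdot)$. The native space $H=\overline{\operatorname{span}\{K_x : x\in X\}}$ is the reproducing kernel Hilbert space of real-valued functions on $X$ with reproducing kernel $K$. For $x\in X$, $E_x:H\to\mathbb{R}$ is the evaluation functional $E_xf=f(x)=\langle K_x,f\rangle_H$, and its adjoint $E_x^*:\mathbb{R}\to H$ is $E_x^*\alpha=\alpha K_x$. The tensor product operator $K_x\otimes K_x:H\to H$ is $(K_x\otimes K_x)g=\langle K_x,g\rangle_H K_x$, so that $K_x\otimes K_x=E_x^*E_x$. $\mathcal{L}(H)$ is the space of bounded linear operators on $H$ with the operator norm, $\mathcal{B}_{\mathcal{L}(H)}$ is its Borel $\sigma$-algebra, and $\mathcal{B}_{\mathbb{T}}$ is the Borel $\sigma$-algebra of $\mathbb{T}$. The integral defining $T_\phi(s,t)g$ is a Bochner integral of an $H$-valued function. Positive means $\langle T_\phi(s,t)g,g\rangle_H\ge 0$ for all $g\in H$. *)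

theory Defs
  imports "HOL-Analysis.Analysis"
begin

section \<open>Kernels and their native spaces\<close>

definition admissible_kernel :: "('x \<Rightarrow> 'x \<Rightarrow> real) \<Rightarrow> bool" where
  "admissible_kernel K \<longleftrightarrow>
     (\<forall>x y. K x y = K y x) \<and>
     (\<forall>A c. finite A \<longrightarrow> 0 \<le> (\<Sum>x\<in>A. \<Sum>y\<in>A. c x * c y * K x y))"

text \<open>
  A Hilbert space of functions on \<open>'x\<close> is a complete inner product space \<open>'h\<close> together with
  the inclusion \<open>\<iota> :: 'h \<Rightarrow> ('x \<Rightarrow> real)\<close>; \<open>\<iota> f x\<close> is the value at \<open>x\<close> of the function \<open>f\<close>.
  The inclusion is injective and the vector operations of \<open>'h\<close> are the pointwise ones.
  (Operators on the space and its operator norm then live in the type \<open>'h \<Rightarrow>\<^sub>L 'h\<close>.)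
\<close>

definition function_space :: "('h::real_vector \<Rightarrow> 'x \<Rightarrow> real) \<Rightarrow> bool" where
  "function_space \<iota> \<longleftrightarrow> inj \<iota> \<and> (\<forall>x. linear (\<lambda>f. \<iota> f x))"

text \<open>The function \<open>K(x, \<cdot>)\<close> as an element of the space.\<close>

definition kernel_at :: "('h \<Rightarrow> 'x \<Rightarrow> real) \<Rightarrow> ('x \<Rightarrow> 'x \<Rightarrow> real) \<Rightarrow> 'x \<Rightarrow> 'h" where
  "kernel_at \<iota> K x = inv \<iota> (K x)"

definition native_space ::
    "('x \<Rightarrow> 'x \<Rightarrow> real) \<Rightarrow> ('h::{real_inner,complete_space} \<Rightarrow> 'x \<Rightarrow> real) \<Rightarrow> bool" where
  "native_space K \<iota> \<longleftrightarrow>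
     function_space \<iota> \<and>
     (\<forall>x. K x \<in> range \<iota>) \<and>
     (\<forall>f x. \<iota> f x = kernel_at \<iota> K x \<bullet> f) \<and>
     closure (span (range (kernel_at \<iota> K))) = UNIV"

definition eval_op :: "('h::real_inner \<Rightarrow> 'x \<Rightarrow> real) \<Rightarrow> 'x \<Rightarrow> 'h \<Rightarrow>\<^sub>L real" where
  "eval_op \<iota> x = Blinfun (\<lambda>f. \<iota> f x)"

definition eval_adj :: "('h::real_inner \<Rightarrow> 'x \<Rightarrow> real) \<Rightarrow> 'x \<Rightarrow> real \<Rightarrow>\<^sub>L 'h" where
  "eval_adj \<iota> x = Blinfun (adjoint (blinfun_apply (eval_op \<iota> x)))"

lift_definition tensor_op :: "'h::real_inner \<Rightarrow> 'h \<Rightarrow> 'h \<Rightarrow>\<^sub>L 'h"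
  is "\<lambda>a b g. (b \<bullet> g) *\<^sub>R a"
  by (intro bounded_linear_intros)

lemma kernel_at_apply:
  assumes "native_space K \<iota>"
  shows "\<iota> (kernel_at \<iota> K x) = K x"
  using assms unfolding native_space_def kernel_at_def by (blast intro: f_inv_into_f)

lemma eval_op_apply:
  assumes "native_space K \<iota>"
  shows "blinfun_apply (eval_op \<iota> x) f = \<iota> f x"
proof -
  have "(\<lambda>f. \<iota> f x) = (\<lambda>f. kernel_at \<iota> K x \<bullet> f)"
    using assms by (simp add: native_space_def)
  then have "bounded_linear (\<lambda>f. \<iota> f x)"
    by (simp add: bounded_linear_inner_right)
  then show ?thesis
    by (simp add: eval_op_def bounded_linear_Blinfun_apply)
qed

lemma eval_adj_apply:
  assumes "native_space K \<iota>"
  shows "blinfun_apply (eval_adj \<iota> x) \<alpha> = \<alpha> *\<^sub>R kernel_at \<iota> K x"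
proof -
  have "adjoint (blinfun_apply (eval_op \<iota> x)) = (\<lambda>\<alpha>. \<alpha> *\<^sub>R kernel_at \<iota> K x)"
    using assms
    by (intro adjoint_unique)
      (auto simp: eval_op_apply[OF assms] native_space_def inner_commute)
  then show ?thesis
    by (simp add: eval_adj_def bounded_linear_Blinfun_apply bounded_linear_scaleR_left)
qed

text \<open>If the kernel is continuous, the native space consists of continuous functions.\<close>

lemma native_space_continuous:
  fixes K :: "'x::topological_space \<Rightarrow> 'x \<Rightarrow> real"
  assumes "continuous_on UNIV (\<lambda>(x, y). K x y)" "native_space K \<iota>"
  shows "continuous_on UNIV (\<iota> f)"
proof -
  let ?k = "kernel_at \<iota> K"
  have kk: "?k x \<bullet> ?k y = K y x" for x y
  proof -
    have "?k x \<bullet> ?k y = \<iota> (?k y) x"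
      using assms(2) by (simp add: native_space_def)
    then show ?thesis
      by (simp add: kernel_at_apply[OF assms(2)])
  qed
  have "(\<lambda>y. (K y y - K x y - K y x + K x x)) \<midarrow>x\<rightarrow> K x x - K x x - K x x + K x x" for x
  proof -
    have "continuous_on UNIV (\<lambda>y. K (p y) (q y))"
      if "continuous_on UNIV p" "continuous_on UNIV q" for p q :: "'x \<Rightarrow> 'x"
      using continuous_on_compose2[OF assms(1) continuous_on_Pair[OF that]] by simp
    from this[of "\<lambda>y. y" "\<lambda>y. y"] this[of "\<lambda>y. x" "\<lambda>y. y"] this[of "\<lambda>y. y" "\<lambda>y. x"]
    have "(\<lambda>y. K y y) \<midarrow>x\<rightarrow> K x x" "(\<lambda>y. K x y) \<midarrow>x\<rightarrow> K x x" "(\<lambda>y. K y x) \<midarrow>x\<rightarrow> K x x"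
      by (simp_all add: continuous_on_def)
    then show ?thesis by (intro tendsto_intros)
  qed
  then have "(\<lambda>y. sqrt (K y y - K x y - K y x + K x x)) \<midarrow>x\<rightarrow> sqrt 0" for x
    using tendsto_real_sqrt by fastforce
  moreover have "norm (?k y - ?k x) = sqrt (K y y - K x y - K y x + K x x)" for x y
    by (simp add: norm_eq_sqrt_inner inner_diff_left inner_diff_right kk)
  ultimately have "(\<lambda>y. norm (?k y - ?k x)) \<midarrow>x\<rightarrow> 0" for x
    by simp
  then have "?k \<midarrow>x\<rightarrow> ?k x" for x
    by (simp add: tendsto_norm_zero_iff LIM_zero_iff)
  then have "(\<lambda>y. ?k y \<bullet> f) \<midarrow>x\<rightarrow> ?k x \<bullet> f" for x
    by (intro tendsto_intros)
  moreover have "\<iota> f = (\<lambda>y. ?k y \<bullet> f)"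
    using assms(2) by (auto simp: native_space_def)
  ultimately show ?thesis
    by (simp add: continuous_on_def)
qed


section \<open>Bochner integral in an arbitrary normed space\<close>

text \<open>
  The library's Bochner integral requires a second countable range, which excludes the space of
  bounded operators. Here Borel measurability of the integrand is replaced by strong measurability;
  for second countable ranges the two integrals agree.
\<close>

definition strongly_measurable :: "'a measure \<Rightarrow> ('a \<Rightarrow> 'b::real_normed_vector) \<Rightarrow> bool" where
  "strongly_measurable M f \<longleftrightarrow>
     (\<exists>u. (\<forall>i. simple_function M (u i)) \<and> (\<forall>x\<in>space M. (\<lambda>i. u i x) \<longlonglongrightarrow> f x))"

definition has_Bochner :: "'a measure \<Rightarrow> ('a \<Rightarrow> 'b::real_normed_vector) \<Rightarrow> 'b \<Rightarrow> bool" where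
  "has_Bochner M f I \<longleftrightarrow>
     strongly_measurable M f \<and>
     (\<exists>u. (\<forall>i. Bochner_Integration.simple_bochner_integrable M (u i)) \<and>
          (\<lambda>i. \<integral>\<^sup>+x. ennreal (norm (f x - u i x)) \<partial>M) \<longlonglongrightarrow> 0 \<and>
          (\<lambda>i. Bochner_Integration.simple_bochner_integral M (u i)) \<longlonglongrightarrow> I)"

definition Bochner_integrable :: "'a measure \<Rightarrow> ('a \<Rightarrow> 'b::real_normed_vector) \<Rightarrow> bool" where
  "Bochner_integrable M f \<longleftrightarrow> (\<exists>I. has_Bochner M f I)"

definition Bochner :: "'a measure \<Rightarrow> ('a \<Rightarrow> 'b::real_normed_vector) \<Rightarrow> 'b" where
  "Bochner M f = (THE I. has_Bochner M f I)"

lemma has_Bochner_iff_has_bochner_integral: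
  fixes f :: "'a \<Rightarrow> 'b::{real_normed_vector,second_countable_topology}"
  shows "has_Bochner M f I \<longleftrightarrow> has_bochner_integral M f I"
proof -
  have "strongly_measurable M f \<longleftrightarrow> f \<in> borel_measurable M"
  proof
    assume "strongly_measurable M f"
    then obtain u where u: "\<And>i. simple_function M (u i)"
      "\<And>x. x \<in> space M \<Longrightarrow> (\<lambda>i. u i x) \<longlonglongrightarrow> f x"
      unfolding strongly_measurable_def by blast
    show "f \<in> borel_measurable M"
      by (rule borel_measurable_LIMSEQ_metric[OF borel_measurable_simple_function[OF u(1)] u(2)])
  next
    assume "f \<in> borel_measurable M"
    from borel_measurable_implies_sequence_metric[OF this, of 0]
    show "strongly_measurable M f"
      unfolding strongly_measurable_def by blast
  qed
  then show ?thesis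
    unfolding has_Bochner_def has_bochner_integral.simps by auto
qed


section \<open>Classes of operators on a Hilbert space\<close>

definition self_adjoint :: "('h::real_inner \<Rightarrow> 'h) \<Rightarrow> bool" where
  "self_adjoint T \<longleftrightarrow> bounded_linear T \<and> (\<forall>f g. T f \<bullet> g = f \<bullet> T g)"

definition positive_op :: "('h::real_inner \<Rightarrow> 'h) \<Rightarrow> bool" where
  "positive_op T \<longleftrightarrow> (\<forall>g. 0 \<le> T g \<bullet> g)"

definition compact_op :: "('h::real_normed_vector \<Rightarrow> 'h) \<Rightarrow> bool" where
  "compact_op T \<longleftrightarrow> linear T \<and> compact (closure (T ` cball 0 1))"

definition orthonormal_basis :: "'h::real_inner set \<Rightarrow> bool" where
  "orthonormal_basis B \<longleftrightarrow>
     pairwise orthogonal B \<and> (\<forall>e\<in>B. norm e = 1) \<and> closure (span B) = UNIV"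

text \<open>
  \<open>T\<close> is trace class if \<open>\<Sum>\<^sub>e \<langle>|T| e, e\<rangle> < \<infinity>\<close> for some orthonormal basis (equivalently, for all).
  Below, \<open>A\<close> is \<open>|T|\<close>, the unique positive square root of \<open>T\<^sup>* T\<close>.
\<close>

definition trace_class :: "('h::{real_inner,complete_space} \<Rightarrow> 'h) \<Rightarrow> bool" where
  "trace_class T \<longleftrightarrow>
     bounded_linear T \<and>
     (\<exists>A B. self_adjoint A \<and> positive_op A \<and> A \<circ> A = adjoint T \<circ> T \<and>
        orthonormal_basis B \<and> (\<lambda>e. A e \<bullet> e) summable_on B)"


section \<open>The operator along a trajectory\<close>

text \<open>\<open>\<nu>\<close> is a measure on \<open>[s, t]\<close>; the interval of integration is its underlying space.\<close>

definition T_op ::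
    "('h::real_inner \<Rightarrow> 'x \<Rightarrow> real) \<Rightarrow> (real \<Rightarrow> 'x) \<Rightarrow> real measure \<Rightarrow> 'h \<Rightarrow> 'h" where
  "T_op \<iota> \<phi> \<nu> g =
     Bochner \<nu> (\<lambda>\<tau>. eval_adj \<iota> (\<phi> \<tau>) (eval_op \<iota> (\<phi> \<tau>) g))"

end

(*
  The map \<tau> \<mapsto> K_\<phi>(\<tau>) is continuous on the compact interval, so \<tau> \<mapsto> K_\<phi>(\<tau>) \<otimes> K_\<phi>(\<tau>) is a
  uniform limit of step functions in operator norm. Hence its Bochner integral S exists and lies in
  the closed span of the rank one operators K_\<phi>(\<tau>) \<otimes> K_\<phi>(\<tau>), which makes S compact. Bounded
  linear maps commute with the integral: evaluation at g gives T = S, and pairing with h gives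
  \<langle>T g, h\<rangle> = \<integral> \<langle>K_\<phi>(\<tau>), g\<rangle> \<langle>K_\<phi>(\<tau>), h\<rangle> d\<nu>, from which the integral formula, symmetry and positivity
  are read off. As T is positive, |T| = T, and Bessel's inequality under the integral bounds the
  partial sums of its trace by Kbar^2 \<nu>([s, t]).
*)
theory Submission
  imports Defs
begin

section \<open>Bochner integrals with values in a normed space\<close>

lemma has_Bochner_real_iff:
  fixes f :: "'a \<Rightarrow> real"
  shows "has_Bochner M f I \<longleftrightarrow> integrable M f \<and> (\<integral>x. f x \<partial>M) = I"
  by (simp add: has_Bochner_iff_has_bochner_integral has_bochner_integral_iff)

text \<open>In a nonseparable range a difference of Borel functions may fail to be Borel, so the
  real function is obtained as a pointwise limit of the simple functions
  \<open>norm (v i x - u x)\<close>. This measurability is what permits additivity and scaling of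
  the nonnegative integrals below.\<close>

lemma strongly_measurable_norm_diff:
  assumes "strongly_measurable M f" "simple_function M u"
  shows "(\<lambda>x. norm (f x - u x)) \<in> borel_measurable M"
proof -
  obtain v where v: "\<And>i. simple_function M (v i)"
      "\<And>x. x \<in> space M \<Longrightarrow> (\<lambda>i. v i x) \<longlonglongrightarrow> f x"
    using assms(1) unfolding strongly_measurable_def by blast
  show ?thesis
  proof (rule borel_measurable_LIMSEQ_metric)
    show "(\<lambda>x. norm (v i x - u x)) \<in> borel_measurable M" for i
      by (rule borel_measurable_simple_function)
        (rule simple_function_compose2[OF v(1) assms(2), where h = "\<lambda>a b. norm (a - b)"])
    show "(\<lambda>i. norm (v i x - u x)) \<longlonglongrightarrow> norm (f x - u x)" if "x \<in> space M" for x
      using v(2)[OF that] by (intro tendsto_intros)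
  qed
qed

text \<open>The difference of the integrals is the integral of a simple function, to which the norm
  bound applies. Thus the integral of simple functions is 1-Lipschitz for the L1 distance, which
  serves both uniqueness and the Cauchy property.\<close>

lemma norm_simple_bochner_integral_diff_le:
  assumes "Bochner_Integration.simple_bochner_integrable M u" "Bochner_Integration.simple_bochner_integrable M v"
  shows "ennreal (norm (Bochner_Integration.simple_bochner_integral M u - Bochner_Integration.simple_bochner_integral M v))
    \<le> (\<integral>\<^sup>+x. ennreal (norm (u x - v x)) \<partial>M)"
proof -
  have d: "Bochner_Integration.simple_bochner_integrable M (\<lambda>x. u x - v x)"
    using assms by (intro simple_bochner_integrable_compose2[where p = "(-)"]) auto
  then have n: "Bochner_Integration.simple_bochner_integrable M (\<lambda>x. norm (u x - v x))"
    by (intro simple_bochner_integrable_compose2[where p = "\<lambda>a b. norm a" and g = "\<lambda>x. u x - v x"]) auto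
  have "ennreal (norm (Bochner_Integration.simple_bochner_integral M u - Bochner_Integration.simple_bochner_integral M v))
      \<le> ennreal (Bochner_Integration.simple_bochner_integral M (\<lambda>x. norm (u x - v x)))"
    using simple_bochner_integral_norm_bound[OF d] assms
    by (intro ennreal_leI) (simp add: simple_bochner_integral_diff)
  also have "\<dots> = (\<integral>\<^sup>+x. ennreal (norm (u x - v x)) \<partial>M)"
    using n by (intro simple_bochner_integral_eq_nn_integral) auto
  finally show ?thesis .
qed

text \<open>Two sequences that approximate \<open>f\<close> in L1 are close to each other in L1,
  hence so are their integrals. This makes the definite description in \<open>Bochner\<close>
  meaningful.\<close>

lemma has_Bochner_unique:
  assumes "has_Bochner M f I" "has_Bochner M f J"
  shows "I = J"
proof -
  have sm: "strongly_measurable M f"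
    using assms(1) by (simp add: has_Bochner_def)
  obtain u where u: "\<And>i. Bochner_Integration.simple_bochner_integrable M (u i)"
      "(\<lambda>i. \<integral>\<^sup>+x. ennreal (norm (f x - u i x)) \<partial>M) \<longlonglongrightarrow> 0"
      "(\<lambda>i. Bochner_Integration.simple_bochner_integral M (u i)) \<longlonglongrightarrow> I"
    using assms(1) unfolding has_Bochner_def by blast
  obtain v where v: "\<And>i. Bochner_Integration.simple_bochner_integrable M (v i)"
      "(\<lambda>i. \<integral>\<^sup>+x. ennreal (norm (f x - v i x)) \<partial>M) \<longlonglongrightarrow> 0"
      "(\<lambda>i. Bochner_Integration.simple_bochner_integral M (v i)) \<longlonglongrightarrow> J"
    using assms(2) unfolding has_Bochner_def by blast
  let ?d = "\<lambda>i. norm (Bochner_Integration.simple_bochner_integral M (u i) - Bochner_Integration.simple_bochner_integral M (v i))"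
  let ?e = "\<lambda>i. (\<integral>\<^sup>+x. ennreal (norm (f x - u i x)) \<partial>M) + (\<integral>\<^sup>+x. ennreal (norm (f x - v i x)) \<partial>M)"
  have le: "ennreal (?d i) \<le> ?e i" for i
  proof -
    have m: "(\<lambda>x. norm (f x - u i x)) \<in> borel_measurable M" "(\<lambda>x. norm (f x - v i x)) \<in> borel_measurable M"
      using u(1)[of i] v(1)[of i]
      by (intro strongly_measurable_norm_diff[OF sm]; simp add: simple_bochner_integrable.simps)+
    have "ennreal (?d i) \<le> (\<integral>\<^sup>+x. ennreal (norm (u i x - v i x)) \<partial>M)"
      by (intro norm_simple_bochner_integral_diff_le u v)
    also have "\<dots> \<le> (\<integral>\<^sup>+x. ennreal (norm (f x - u i x)) + ennreal (norm (f x - v i x)) \<partial>M)"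
    proof (rule nn_integral_mono)
      fix x
      have "norm (u i x - v i x) \<le> norm (f x - u i x) + norm (f x - v i x)"
        using norm_triangle_ineq4[of "f x - v i x" "f x - u i x"] by simp
      then show "ennreal (norm (u i x - v i x)) \<le> ennreal (norm (f x - u i x)) + ennreal (norm (f x - v i x))"
        by (simp flip: ennreal_plus)
    qed
    also have "\<dots> = ?e i"
      using m by (intro nn_integral_add) auto
    finally show ?thesis .
  qed
  have "?e \<longlonglongrightarrow> 0"
    using tendsto_add[OF u(2) v(2)] by simp
  then have "(\<lambda>i. ennreal (?d i)) \<longlonglongrightarrow> 0"
    by (rule tendsto_sandwich[rotated 3]) (use le in \<open>auto intro: tendsto_const\<close>)
  then have "?d \<longlonglongrightarrow> 0"
    by (simp flip: ennreal_0 add: tendsto_ennreal_iff)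
  moreover have "?d \<longlonglongrightarrow> norm (I - J)"
    by (intro tendsto_intros u v)
  ultimately show ?thesis
    using LIMSEQ_unique by fastforce
qed

lemma Bochner_eqI: "has_Bochner M f I \<Longrightarrow> Bochner M f = I"
  unfolding Bochner_def using has_Bochner_unique by blast

text \<open>The approximating simple functions are pushed through \<open>L\<close>: the L1 error
  grows at most by a bound \<open>C\<close> of \<open>L\<close>, and \<open>L\<close> commutes with
  the finite sum that integrates a simple function. The sequence \<open>w\<close> witnesses strong
  measurability, the sequence \<open>u\<close> convergence in L1; they may differ.\<close>

lemma has_Bochner_bounded_linear:
  assumes "bounded_linear L" "has_Bochner M f I"
  shows "has_Bochner M (\<lambda>x. L (f x)) (L I)"
proof -
  interpret bounded_linear L by fact
  obtain C where C: "\<And>x. norm (L x) \<le> norm x * C" and C0: "0 \<le> C"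
    using nonneg_bounded by blast
  have sm: "strongly_measurable M f"
    using assms(2) by (simp add: has_Bochner_def)
  obtain w where w: "\<And>i. simple_function M (w i)"
      "\<And>x. x \<in> space M \<Longrightarrow> (\<lambda>i. w i x) \<longlonglongrightarrow> f x"
    using sm unfolding strongly_measurable_def by blast
  obtain u where u: "\<And>i. Bochner_Integration.simple_bochner_integrable M (u i)"
      "(\<lambda>i. \<integral>\<^sup>+x. ennreal (norm (f x - u i x)) \<partial>M) \<longlonglongrightarrow> 0"
      "(\<lambda>i. Bochner_Integration.simple_bochner_integral M (u i)) \<longlonglongrightarrow> I"
    using assms(2) unfolding has_Bochner_def by blast
  have "strongly_measurable M (\<lambda>x. L (f x))"
    unfolding strongly_measurable_def
    by (rule exI[where x = "\<lambda>i x. L (w i x)"])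
      (use w in \<open>auto intro: tendsto simple_function_compose1\<close>)
  moreover have "Bochner_Integration.simple_bochner_integrable M (\<lambda>x. L (u i x))" for i
    by (intro simple_bochner_integrable_compose2[where p = "\<lambda>a b. L a" and g = "u i"] u) (simp add: zero)
  moreover have "(\<lambda>i. \<integral>\<^sup>+x. ennreal (norm (L (f x) - L (u i x))) \<partial>M) \<longlonglongrightarrow> 0"
  proof -
    have le: "(\<integral>\<^sup>+x. ennreal (norm (L (f x) - L (u i x))) \<partial>M)
        \<le> ennreal C * (\<integral>\<^sup>+x. ennreal (norm (f x - u i x)) \<partial>M)" for i
    proof -
      have m: "(\<lambda>x. norm (f x - u i x)) \<in> borel_measurable M"
        using u(1)[of i]
        by (auto intro!: strongly_measurable_norm_diff[OF sm] simp: simple_bochner_integrable.simps)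
      have "(\<integral>\<^sup>+x. ennreal (norm (L (f x) - L (u i x))) \<partial>M)
          \<le> (\<integral>\<^sup>+x. ennreal C * ennreal (norm (f x - u i x)) \<partial>M)"
        using C C0
        by (intro nn_integral_mono) (simp add: ennreal_mult[symmetric] mult.commute flip: diff)
      also have "\<dots> = ennreal C * (\<integral>\<^sup>+x. ennreal (norm (f x - u i x)) \<partial>M)"
        using m by (intro nn_integral_cmult) auto
      finally show ?thesis .
    qed
    have "(\<lambda>i. ennreal C * (\<integral>\<^sup>+x. ennreal (norm (f x - u i x)) \<partial>M)) \<longlonglongrightarrow> ennreal C * 0"
      by (intro ennreal_tendsto_cmult u) simp
    then have "(\<lambda>i. ennreal C * (\<integral>\<^sup>+x. ennreal (norm (f x - u i x)) \<partial>M)) \<longlonglongrightarrow> 0"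
      by simp
    then show ?thesis
      by (rule tendsto_sandwich[rotated 3]) (use le in \<open>auto intro: tendsto_const\<close>)
  qed
  moreover have "(\<lambda>i. Bochner_Integration.simple_bochner_integral M (\<lambda>x. L (u i x))) \<longlonglongrightarrow> L I"
    using tendsto[OF u(3)] u(1) by (simp add: simple_bochner_integral_linear linear_axioms)
  ultimately show ?thesis
    unfolding has_Bochner_def by (intro conjI exI[where x = "\<lambda>i x. L (u i x)"]) auto
qed

section \<open>Existence of the integral for continuous functions on an interval\<close>

lemma simple_bochner_integrable_finite_measure:
  "finite_measure M \<Longrightarrow> simple_function M u \<Longrightarrow> Bochner_Integration.simple_bochner_integrable M u"
  by (simp add: simple_bochner_integrable.intros finite_measure.emeasure_finite)

text \<open>On a finite measure space uniform convergence implies convergence in L1, so the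
  integrals of the \<open>u i\<close> form a Cauchy sequence. Their convergence to \<open>I\<close>
  is part of the conclusion because it later locates \<open>I\<close> in a closed span.\<close>

lemma has_Bochner_uniform_limit:
  fixes f :: "'a \<Rightarrow> 'b::real_normed_vector"
  assumes "complete (UNIV :: 'b set)" and fin: "finite_measure M"
    and u: "\<And>i. simple_function M (u i)"
    and lim: "uniform_limit (space M) u f sequentially"
  obtains I where "has_Bochner M f I" "(\<lambda>i. Bochner_Integration.simple_bochner_integral M (u i)) \<longlonglongrightarrow> I"
proof -
  have sbi: "Bochner_Integration.simple_bochner_integrable M (u i)" for i
    by (intro simple_bochner_integrable_finite_measure fin u)
  let ?m = "measure M (space M)"
  have bound: "(\<integral>\<^sup>+x. ennreal (norm (g x)) \<partial>M) \<le> ennreal (e * ?m)"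
    if "\<And>x. x \<in> space M \<Longrightarrow> norm (g x) \<le> e" "0 \<le> e" for g :: "'a \<Rightarrow> 'b" and e
  proof -
    have "(\<integral>\<^sup>+x. ennreal (norm (g x)) \<partial>M) \<le> (\<integral>\<^sup>+x. ennreal e \<partial>M)"
      using that by (intro nn_integral_mono ennreal_leI)
    also have "\<dots> = ennreal (e * ?m)"
      using that(2) by (simp add: finite_measure.emeasure_eq_measure[OF fin] ennreal_mult)
    finally show ?thesis .
  qed
  \<comment> \<open>The denominator \<open>?m + 1\<close> is positive even if the measure vanishes,
    and integrating the constant \<open>e / (?m + 1)\<close> gives strictly less than
    \<open>e\<close>.\<close>
  have ev: "\<forall>\<^sub>F i in sequentially. \<forall>x\<in>space M. norm (u i x - f x) \<le> e / (?m + 1)" if "e > 0" for e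
  proof -
    have "e / (?m + 1) > 0"
      using that by (intro divide_pos_pos add_nonneg_pos) auto
    from uniform_limitD[OF lim this] show ?thesis
      by (rule eventually_mono) (auto simp: dist_norm intro: less_imp_le)
  qed
  have small: "e / (?m + 1) * ?m < e" "0 \<le> e / (?m + 1)" if "e > 0" for e
  proof -
    have "?m + 1 > 0" by (intro add_nonneg_pos) auto
    then show "e / (?m + 1) * ?m < e" "0 \<le> e / (?m + 1)"
      using that by (auto simp: field_simps)
  qed
  have "Cauchy (\<lambda>i. Bochner_Integration.simple_bochner_integral M (u i))"
  proof (rule metric_CauchyI)
    fix e :: real assume "e > 0"
    then have e2: "e / 2 > 0" by simp
    obtain N where N: "\<And>i x. i \<ge> N \<Longrightarrow> x \<in> space M \<Longrightarrow> norm (u i x - f x) \<le> e / 2 / (?m + 1)"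
      using ev[OF e2] unfolding eventually_sequentially by blast
    have "dist (Bochner_Integration.simple_bochner_integral M (u i)) (Bochner_Integration.simple_bochner_integral M (u j)) < e"
      if "i \<ge> N" "j \<ge> N" for i j
    proof -
      have "ennreal (norm (Bochner_Integration.simple_bochner_integral M (u i) - Bochner_Integration.simple_bochner_integral M (u j)))
          \<le> (\<integral>\<^sup>+x. ennreal (norm (u i x - u j x)) \<partial>M)"
        by (intro norm_simple_bochner_integral_diff_le sbi)
      also have "\<dots> \<le> ennreal (e / (?m + 1) * ?m)"
      proof (rule bound)
        fix x assume "x \<in> space M"
        then have "norm ((u i x - f x) - (u j x - f x)) \<le> e / 2 / (?m + 1) + e / 2 / (?m + 1)"
          using N that by (intro order_trans[OF norm_triangle_ineq4 add_mono]) auto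
        also have "\<dots> = e / (?m + 1)"
          by (metis add_divide_distrib field_sum_of_halves)
        finally show "norm (u i x - u j x) \<le> e / (?m + 1)"
          by simp
      qed (use small[OF \<open>e > 0\<close>] in auto)
      finally have "norm (Bochner_Integration.simple_bochner_integral M (u i) - Bochner_Integration.simple_bochner_integral M (u j))
          \<le> e / (?m + 1) * ?m"
        using small[OF \<open>e > 0\<close>] by (subst (asm) ennreal_le_iff) (auto intro: mult_nonneg_nonneg simp del: times_divide_eq_left)
      then show ?thesis
        using small[OF \<open>e > 0\<close>] by (simp add: dist_norm)
    qed
    then show "\<exists>N. \<forall>i\<ge>N. \<forall>j\<ge>N.
        dist (Bochner_Integration.simple_bochner_integral M (u i)) (Bochner_Integration.simple_bochner_integral M (u j)) < e"
      by blast
  qed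
  then obtain I where I: "(\<lambda>i. Bochner_Integration.simple_bochner_integral M (u i)) \<longlonglongrightarrow> I"
    using assms(1) unfolding complete_def by auto
  have "(\<lambda>i. \<integral>\<^sup>+x. ennreal (norm (f x - u i x)) \<partial>M) \<longlonglongrightarrow> 0"
  proof (rule order_tendstoI)
    fix a :: ennreal assume "0 < a"
    \<comment> \<open>The bound \<open>a\<close> may be infinite; an intermediate
      \<open>b < a\<close> is finite and supplies a real \<open>e\<close>.\<close>
    then obtain b where "0 < b" "b < a"
      using dense by blast
    then obtain e where e: "0 < e" "ennreal e < a"
      by (cases b rule: ennreal_cases) auto
    show "\<forall>\<^sub>F i in sequentially. (\<integral>\<^sup>+x. ennreal (norm (f x - u i x)) \<partial>M) < a"
      using ev[OF e(1)]
    proof eventually_elim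
      case (elim i)
      then have "(\<integral>\<^sup>+x. ennreal (norm (f x - u i x)) \<partial>M) \<le> ennreal (e / (?m + 1) * ?m)"
        using small[OF e(1)] by (intro bound) (auto simp: norm_minus_commute)
      also have "\<dots> \<le> ennreal e"
        using small[OF e(1)] by (intro ennreal_leI) auto
      finally show ?case
        using e by simp
    qed
  qed simp
  moreover have "strongly_measurable M f"
    unfolding strongly_measurable_def using u tendsto_uniform_limitI[OF lim] by blast
  ultimately have "has_Bochner M f I"
    unfolding has_Bochner_def using sbi I by blast
  then show ?thesis
    using I that by blast
qed

text \<open>Rounding down to the grid of mesh \<open>1 / Suc i\<close> moves a point by less than
  the mesh and takes finitely many values on a bounded interval.\<close>

lemma step_approximation:
  fixes s t :: real
  assumes "sets M = sets (restrict_space borel {s..t})"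
  obtains p where "\<And>i. simple_function M (p i)" "\<And>i x. x \<in> {s..t} \<Longrightarrow> p i x \<in> {s..t}"
    "uniform_limit {s..t} p (\<lambda>x. x) sequentially"
proof
  \<comment> \<open>The grid point below \<open>x\<close> may lie to the left of \<open>s\<close>;
    the maximum brings it back into the interval without increasing the distance to
    \<open>x\<close>.\<close>
  define p where "p i x = max s (real_of_int \<lfloor>x * real (Suc i)\<rfloor> / real (Suc i))" for i x
  have le: "real_of_int \<lfloor>x * real (Suc i)\<rfloor> / real (Suc i) \<le> x" for x i
    by (simp add: divide_simps)
  have ge: "x - 1 / real (Suc i) < real_of_int \<lfloor>x * real (Suc i)\<rfloor> / real (Suc i)" for x i
  proof -
    have "x * real (Suc i) - 1 < real_of_int \<lfloor>x * real (Suc i)\<rfloor>"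
      by linarith
    then show ?thesis
      by (subst less_divide_eq) (simp add: algebra_simps)
  qed
  show p_in: "p i x \<in> {s..t}" if "x \<in> {s..t}" for i x
    using that le[of x i] by (auto simp: p_def)
  have sp: "space M = {s..t}"
    using sets_eq_imp_space_eq[OF assms] by (simp add: space_restrict_space)
  show "simple_function M (p i)" for i
  proof (rule simple_function_borel_measurable)
    have "p i \<in> borel_measurable borel"
      unfolding p_def by measurable
    then show "p i \<in> borel_measurable M"
      using measurable_restrict_space1 measurable_cong_sets[OF assms refl] by blast
    have "p i ` space M \<subseteq> (\<lambda>n. max s (real_of_int n / real (Suc i))) `
        {\<lfloor>s * real (Suc i)\<rfloor>..\<lfloor>t * real (Suc i)\<rfloor>}"
      unfolding sp p_def by (auto intro!: imageI floor_mono mult_right_mono)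
    then show "finite (p i ` space M)"
      by (rule finite_subset) simp
  qed
  show "uniform_limit {s..t} p (\<lambda>x. x) sequentially"
  proof (rule uniform_limitI)
    fix e :: real assume "e > 0"
    then have "\<forall>\<^sub>F i in sequentially. 1 / real (Suc i) < e"
      using LIMSEQ_inverse_real_of_nat order_tendstoD(2) by (fastforce simp: inverse_eq_divide)
    then show "\<forall>\<^sub>F i in sequentially. \<forall>x\<in>{s..t}. dist (p i x) x < e"
    proof (rule eventually_mono, intro ballI)
      fix i x assume i: "1 / real (Suc i) < e" and x: "x \<in> {s..t}"
      then show "dist (p i x) x < e"
        using le[of x i] ge[of x i] \<open>e > 0\<close> unfolding p_def dist_real_def max_def
        by (auto simp del: of_nat_Suc)
    qed
  qed
qed

text \<open>By uniform continuity the step functions \<open>f (p i x)\<close> converge uniformly to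
  \<open>f\<close>. As \<open>p i\<close> stays in the interval, their integrals are linear
  combinations of values of \<open>f\<close> there, which puts the limit in the closed span.\<close>

lemma has_Bochner_continuous:
  fixes f :: "real \<Rightarrow> 'b::real_normed_vector"
  assumes "complete (UNIV :: 'b set)" and fin: "finite_measure M"
    and sets: "sets M = sets (restrict_space borel {s..t})"
    and f: "continuous_on {s..t} f"
  obtains I where "has_Bochner M f I" "I \<in> closure (span (f ` {s..t}))"
proof -
  have sp: "space M = {s..t}"
    using sets_eq_imp_space_eq[OF sets] by (simp add: space_restrict_space)
  obtain p where p: "\<And>i. simple_function M (p i)" "\<And>i x. x \<in> {s..t} \<Longrightarrow> p i x \<in> {s..t}"
    "uniform_limit {s..t} p (\<lambda>x. x) sequentially"
    using step_approximation[OF sets] by blast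
  have "uniformly_continuous_on {s..t} f"
    using f compact_uniformly_continuous by blast
  then have lim: "uniform_limit (space M) (\<lambda>i x. f (p i x)) f sequentially"
    unfolding sp
  proof (intro uniform_limitI)
    fix e :: real assume uc: "uniformly_continuous_on {s..t} f" and "e > 0"
    then obtain d where d: "d > 0" "\<And>x y. x \<in> {s..t} \<Longrightarrow> y \<in> {s..t} \<Longrightarrow> dist y x < d \<Longrightarrow> dist (f y) (f x) < e"
      unfolding uniformly_continuous_on_def by metis
    show "\<forall>\<^sub>F i in sequentially. \<forall>x\<in>{s..t}. dist (f (p i x)) (f x) < e"
      using uniform_limitD[OF p(3) d(1)] by eventually_elim (use d(2) p(2) in blast)
  qed
  obtain I where I: "has_Bochner M f I" "(\<lambda>i. Bochner_Integration.simple_bochner_integral M (\<lambda>x. f (p i x))) \<longlonglongrightarrow> I"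
    using has_Bochner_uniform_limit[OF assms(1) fin simple_function_compose1[OF p(1)] lim] by blast
  have "Bochner_Integration.simple_bochner_integral M (\<lambda>x. f (p i x)) \<in> span (f ` {s..t})" for i
    unfolding simple_bochner_integral_def sp
    using p(2) by (intro span_sum span_scale span_base) auto
  then have "I \<in> closure (span (f ` {s..t}))"
    using I(2) unfolding closure_sequential
    by (intro exI[where x = "\<lambda>i. Bochner_Integration.simple_bochner_integral M (\<lambda>x. f (p i x))"]) auto
  with I(1) show ?thesis
    using that by blast
qed


section \<open>Operators on a Hilbert space\<close>

text \<open>
  The sort of the range is not a subsort of the class banach, although it has the same axioms, so
  the library's completeness of the space of bounded operators does not apply.
\<close>

lemma complete_UNIV_blinfun:
  "complete (UNIV :: ('a::real_normed_vector \<Rightarrow>\<^sub>L 'b::{real_normed_vector,complete_space}) set)"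
  unfolding complete_def
proof (intro allI impI, elim conjE)
  fix X :: "nat \<Rightarrow> 'a \<Rightarrow>\<^sub>L 'b" assume X: "Cauchy X"
  have "Cauchy (\<lambda>n. X n x)" for x
    using X by (rule bounded_linear.Cauchy[OF blinfun.bounded_linear_left])
  then obtain v where v: "\<And>x. (\<lambda>n. X n x) \<longlonglongrightarrow> v x"
    unfolding Cauchy_convergent_iff convergent_def by metis
  obtain C where C: "\<And>n. norm (X n) \<le> C"
    using Cauchy_Bseq[OF X] unfolding Bseq_def by blast
  have "bounded_linear v"
  proof (rule bounded_linear_intro)
    show "v (x + y) = v x + v y" for x y
    proof (rule LIMSEQ_unique[OF v])
      show "(\<lambda>n. X n (x + y)) \<longlonglongrightarrow> v x + v y"
        unfolding blinfun.add_right by (intro tendsto_add v)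
    qed
    show "v (r *\<^sub>R x) = r *\<^sub>R v x" for r x
    proof (rule LIMSEQ_unique[OF v])
      show "(\<lambda>n. X n (r *\<^sub>R x)) \<longlonglongrightarrow> r *\<^sub>R v x"
        unfolding blinfun.scaleR_right by (intro tendsto_scaleR tendsto_const v)
    qed
    show "norm (v x) \<le> norm x * C" for x
    proof (rule LIMSEQ_le_const2[OF tendsto_norm[OF v]], intro exI allI impI)
      show "norm (X n x) \<le> norm x * C" for n
        using norm_blinfun[of "X n" x] mult_right_mono[OF C[of n], of "norm x"]
        by (simp add: mult.commute)
    qed
  qed
  then have V: "blinfun_apply (Blinfun v) = v"
    by (rule bounded_linear_Blinfun_apply)
  have "X \<longlonglongrightarrow> Blinfun v"
  proof (rule LIMSEQ_I)
    fix e :: real assume "e > 0"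
    then obtain N where N: "\<And>m n. m \<ge> N \<Longrightarrow> n \<ge> N \<Longrightarrow> norm (X m - X n) < e / 2"
      using CauchyD[OF X, of "e / 2"] by auto
    have "norm (X n - Blinfun v) < e" if "n \<ge> N" for n
    proof -
      \<comment> \<open>Letting \<open>m\<close> tend to infinity in the Cauchy estimate at a fixed
        \<open>x\<close> preserves the weak inequality; the spare half of \<open>e\<close> restores
        the strict one.\<close>
      have "norm (X n - Blinfun v) \<le> e / 2"
      proof (rule norm_blinfun_bound)
        fix x
        have "(\<lambda>m. norm (X n x - X m x)) \<longlonglongrightarrow> norm (X n x - v x)"
          by (intro tendsto_intros v)
        moreover have "norm (X n x - X m x) \<le> e / 2 * norm x" if "m \<ge> N" for m
          using norm_blinfun[of "X n - X m" x]
            mult_right_mono[OF less_imp_le[OF N[OF \<open>n \<ge> N\<close> that]], of "norm x"]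
          by (simp add: blinfun.diff_left)
        ultimately show "norm ((X n - Blinfun v) x) \<le> e / 2 * norm x"
          unfolding blinfun.diff_left V by (intro LIMSEQ_le_const2) auto
      qed (use \<open>e > 0\<close> in simp)
      then show ?thesis using \<open>e > 0\<close> by simp
    qed
    then show "\<exists>N. \<forall>n\<ge>N. norm (X n - Blinfun v) < e" by blast
  qed
  then show "\<exists>l\<in>UNIV. X \<longlonglongrightarrow> l" by blast
qed

section \<open>Compact operators\<close>

text \<open>A compact \<open>C\<close> is closed, so it contains the closure of the image as a
  closed subset. Enclosing the image of the unit ball in a compact set therefore suffices.\<close>

lemma compact_opI:
  assumes "linear T" "T ` cball 0 1 \<subseteq> C" "compact C"
  shows "compact_op T"
proof -
  have "closure (T ` cball 0 1) \<subseteq> C"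
    using assms by (intro closure_minimal compact_imp_closed)
  then have "C \<inter> closure (T ` cball 0 1) = closure (T ` cball 0 1)"
    by blast
  then show ?thesis
    using compact_Int_closed[OF assms(3) closed_closure, of "T ` cball 0 1"] assms(1)
    by (simp add: compact_op_def)
qed

text \<open>Scalings and Minkowski sums of compact sets are compact, and they enclose the images of
  the unit ball under \<open>c *\<^sub>R A\<close> and \<open>A + B\<close>.\<close>

lemma subspace_compact_op:
  "subspace {S :: 'h::real_normed_vector \<Rightarrow>\<^sub>L 'h. compact_op (blinfun_apply S)}"
proof (rule subspaceI; (elim CollectE)?; intro CollectI)
  have lin: "linear (blinfun_apply S)" for S :: "'h \<Rightarrow>\<^sub>L 'h"
    by (simp add: blinfun.bounded_linear_right bounded_linear.linear)
  show "compact_op (blinfun_apply (0 :: 'h \<Rightarrow>\<^sub>L 'h))"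
    by (rule compact_opI[OF lin, of _ "{0}"]) auto
  fix A B :: "'h \<Rightarrow>\<^sub>L 'h" and c :: real
  assume A: "compact_op (blinfun_apply A)"
  let ?cl = "\<lambda>S :: 'h \<Rightarrow>\<^sub>L 'h. closure (blinfun_apply S ` cball 0 1)"
  have in_cl: "S x \<in> ?cl S" if "x \<in> cball 0 1" for S :: "'h \<Rightarrow>\<^sub>L 'h" and x
    by (rule subsetD[OF closure_subset imageI[OF that]])
  show "compact_op (blinfun_apply (c *\<^sub>R A))"
  proof (rule compact_opI[OF lin])
    show "blinfun_apply (c *\<^sub>R A) ` cball 0 1 \<subseteq> (\<lambda>x. c *\<^sub>R x) ` ?cl A"
      using in_cl by (auto simp: blinfun.scaleR_left)
    show "compact ((\<lambda>x. c *\<^sub>R x) ` ?cl A)"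
      using A by (intro compact_scaling) (simp add: compact_op_def)
  qed
  assume B: "compact_op (blinfun_apply B)"
  show "compact_op (blinfun_apply (A + B))"
  proof (rule compact_opI[OF lin])
    show "blinfun_apply (A + B) ` cball 0 1 \<subseteq> {x + y |x y. x \<in> ?cl A \<and> y \<in> ?cl B}"
      unfolding blinfun.add_left using in_cl by blast
    show "compact {x + y |x y. x \<in> ?cl A \<and> y \<in> ?cl B}"
      using A B by (intro compact_sums) (auto simp: compact_op_def)
  qed
qed

text \<open>Total boundedness survives limits in operator norm: a finite net for the image of the
  ball under a nearby compact operator is a coarser net for the image under
  \<open>T\<close>.\<close>

lemma closed_compact_op:
  "closed {S :: 'h::{real_normed_vector,complete_space} \<Rightarrow>\<^sub>L 'h. compact_op (blinfun_apply S)}"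
proof (rule closure_subset_eq[THEN iffD1], rule subsetI, rule CollectI)
  fix T :: "'h \<Rightarrow>\<^sub>L 'h"
  assume T: "T \<in> closure {S. compact_op (blinfun_apply S)}"
  let ?b = "cball (0 :: 'h) 1"
  have "\<exists>F. finite F \<and> closure (T ` ?b) \<subseteq> (\<Union>x\<in>F. ball x e)" if "e > 0" for e
  proof -
    \<comment> \<open>One quarter goes to the net for \<open>S\<close>, one to the distance from
      \<open>S g\<close> to \<open>T g\<close>. The resulting closed balls of radius
      \<open>e / 2\<close> also cover the closure, and they fit into open balls of radius
      \<open>e\<close>.\<close>
    have "e / 4 > 0" using that by simp
    then obtain S where S: "compact_op (blinfun_apply S)" "dist S T < e / 4"
      using T unfolding closure_approachable by blast
    then obtain F where F: "finite F" "closure (S ` ?b) \<subseteq> (\<Union>x\<in>F. ball x (e / 4))"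
      using \<open>e / 4 > 0\<close> unfolding compact_op_def compact_eq_totally_bounded by blast
    have "T ` ?b \<subseteq> (\<Union>x\<in>F. cball x (e / 2))"
    proof (rule image_subsetI)
      fix g assume g: "g \<in> ?b"
      then have "S g \<in> closure (S ` ?b)"
        by (intro subsetD[OF closure_subset imageI])
      then obtain x where x: "x \<in> F" "dist x (S g) < e / 4"
        using F by auto
      have "norm ((S - T) g) \<le> norm (S - T) * norm g"
        by (rule norm_blinfun)
      also have "\<dots> \<le> (e / 4) * 1"
        using S(2) g that by (intro mult_mono) (auto simp: dist_norm)
      finally have "dist (S g) (T g) \<le> e / 4"
        by (simp add: dist_norm blinfun.diff_left)
      then have "dist x (T g) \<le> e / 2"
        using x(2) dist_triangle[of x "T g" "S g"] by linarith
      then show "T g \<in> (\<Union>x\<in>F. cball x (e / 2))"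
        using x(1) by auto
    qed
    then have "closure (T ` ?b) \<subseteq> (\<Union>x\<in>F. cball x (e / 2))"
      using F(1) by (intro closure_minimal closed_UN) auto
    also have "\<dots> \<subseteq> (\<Union>x\<in>F. ball x e)"
      using that by fastforce
    finally show ?thesis
      using F(1) by blast
  qed
  then show "compact_op (blinfun_apply T)"
    unfolding compact_op_def compact_eq_totally_bounded
    by (auto simp: complete_eq_closed blinfun.bounded_linear_right bounded_linear.linear)
qed

section \<open>Rank one operators\<close>

lemma tensor_op_apply [simp]: "tensor_op a b g = (b \<bullet> g) *\<^sub>R a"
  by transfer simp

text \<open>The bound is the Cauchy-Schwarz inequality. Boundedness in both arguments turns norm
  continuity of a curve of vectors into operator norm continuity of its rank one operators.\<close>

lemma bounded_bilinear_tensor_op: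
  "bounded_bilinear (tensor_op :: 'h::real_inner \<Rightarrow> 'h \<Rightarrow> 'h \<Rightarrow>\<^sub>L 'h)"
proof
  fix a a' b b' :: 'h and r :: real
  show "tensor_op (a + a') b = tensor_op a b + tensor_op a' b"
    by (rule blinfun_eqI) (simp add: blinfun.add_left scaleR_add_right)
  show "tensor_op a (b + b') = tensor_op a b + tensor_op a b'"
    by (rule blinfun_eqI) (simp add: blinfun.add_left inner_add_left scaleR_add_left)
  show "tensor_op (r *\<^sub>R a) b = r *\<^sub>R tensor_op a b"
    by (rule blinfun_eqI) (simp add: blinfun.scaleR_left)
  show "tensor_op a (r *\<^sub>R b) = r *\<^sub>R tensor_op a b"
    by (rule blinfun_eqI) (simp add: blinfun.scaleR_left)
  have "norm (tensor_op a b) \<le> norm a * norm b * 1" for a b :: 'h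
  proof (rule norm_blinfun_bound)
    fix g
    have "\<bar>b \<bullet> g\<bar> * norm a \<le> (norm b * norm g) * norm a"
      by (intro mult_right_mono Cauchy_Schwarz_ineq2) simp
    then show "norm (tensor_op a b g) \<le> norm a * norm b * 1 * norm g"
      by (simp add: mult_ac)
  qed simp
  then show "\<exists>C. \<forall>a b :: 'h. norm (tensor_op a b) \<le> norm a * norm b * C"
    by blast
qed

text \<open>By Cauchy-Schwarz the unit ball is mapped into the segment of multiples of
  \<open>a\<close> with coefficients at most \<open>norm b\<close> in absolute value.\<close>

lemma compact_op_tensor: "compact_op (blinfun_apply (tensor_op a b))"
proof (rule compact_opI)
  show "linear (blinfun_apply (tensor_op a b))"
    by (simp add: blinfun.bounded_linear_right bounded_linear.linear)
  show "blinfun_apply (tensor_op a b) ` cball 0 1 \<subseteq> (\<lambda>c. c *\<^sub>R a) ` {- norm b..norm b}"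
  proof (rule image_subsetI)
    fix g :: 'a assume "g \<in> cball 0 1"
    then have "\<bar>b \<bullet> g\<bar> \<le> norm b"
      using Cauchy_Schwarz_ineq2[of b g] mult_left_mono[of "norm g" 1 "norm b"] by simp
    then show "tensor_op a b g \<in> (\<lambda>c. c *\<^sub>R a) ` {- norm b..norm b}"
      unfolding tensor_op_apply by (intro imageI) (simp add: abs_le_iff minus_le_iff)
  qed
  show "compact ((\<lambda>c. c *\<^sub>R a) ` {- norm b..norm b})"
    by (intro compact_continuous_image continuous_intros) auto
qed

section \<open>Orthogonal complements and orthonormal bases\<close>

text \<open>This is the core of the projection theorem: for \<open>a\<close> outside
  \<open>M\<close>, the vector from the nearest point of \<open>M\<close> to \<open>a\<close> is
  orthogonal to \<open>M\<close>.\<close>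

lemma exists_orthogonal_closed_subspace:
  fixes M :: "'h::{real_inner,complete_space} set"
  assumes "subspace M" "closed M" "M \<noteq> UNIV"
  obtains v where "v \<noteq> 0" "\<And>x. x \<in> M \<Longrightarrow> v \<bullet> x = 0"
proof -
  obtain a where a: "a \<notin> M" using assms(3) by blast
  have ne: "M \<noteq> {}" using subspace_0[OF assms(1)] by blast
  define d where "d = infdist a M"
  have d0: "0 \<le> d" by (simp add: d_def infdist_nonneg)
  have dle: "d \<le> norm (a - x)" if "x \<in> M" for x
    using infdist_le[OF that, of a] by (simp add: d_def dist_norm)
  \<comment> \<open>The slack is placed in the squared distance, where the parallelogram law can use
    it directly.\<close>
  have "\<exists>x\<in>M. (norm (a - x))\<^sup>2 < d\<^sup>2 + 1 / real (Suc n)" for n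
  proof -
    have "d < sqrt (d\<^sup>2 + 1 / real (Suc n))"
      using d0 by (intro real_less_rsqrt) simp
    then obtain x where x: "x \<in> M" "dist a x < sqrt (d\<^sup>2 + 1 / real (Suc n))"
      using ne unfolding d_def infdist_def by (auto simp: cINF_less_iff)
    then have "(norm (a - x))\<^sup>2 < (sqrt (d\<^sup>2 + 1 / real (Suc n)))\<^sup>2"
      by (intro power_strict_mono) (auto simp: dist_norm)
    then show ?thesis using x(1) by (auto simp: add_nonneg_nonneg)
  qed
  then obtain x where x: "\<And>n. x n \<in> M" "\<And>n. (norm (a - x n))\<^sup>2 < d\<^sup>2 + 1 / real (Suc n)"
    by metis
  \<comment> \<open>The parallelogram law makes the minimising sequence Cauchy.\<close>
  have par: "(norm (x m - x n))\<^sup>2 \<le> 2 / real (Suc m) + 2 / real (Suc n)" for m n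
  proof -
    have "(1 / 2) *\<^sub>R (x m + x n) \<in> M"
      using x(1) assms(1) by (intro subspace_scale subspace_add)
    then have "d\<^sup>2 \<le> (norm (a - (1 / 2) *\<^sub>R (x m + x n)))\<^sup>2"
      using dle d0 by (intro power_mono) auto
    moreover have "(norm (x m - x n))\<^sup>2 = 2 * (norm (a - x m))\<^sup>2 + 2 * (norm (a - x n))\<^sup>2
        - 4 * (norm (a - (1 / 2) *\<^sub>R (x m + x n)))\<^sup>2"
      by (simp add: power2_norm_eq_inner inner_diff_left inner_diff_right inner_add_left
          inner_add_right inner_commute field_simps)
    ultimately show ?thesis
      using x(2)[of m] x(2)[of n] by simp
  qed
  have "Cauchy x"
  proof (rule metric_CauchyI)
    fix e :: real assume e: "e > 0"
    then obtain N where N: "1 / real (Suc N) < e\<^sup>2 / 4"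
      using nat_approx_posE[of "e\<^sup>2 / 4"] by auto
    have "dist (x m) (x n) < e" if "m \<ge> N" "n \<ge> N" for m n
    proof -
      have "1 / real (Suc m) \<le> 1 / real (Suc N)" "1 / real (Suc n) \<le> 1 / real (Suc N)"
        using that by (auto simp: divide_simps)
      then have "(norm (x m - x n))\<^sup>2 < e\<^sup>2"
        using par[of m n] N by (simp del: of_nat_Suc)
      then show ?thesis
        unfolding dist_norm by (rule power_less_imp_less_base) (rule less_imp_le[OF e])
    qed
    then show "\<exists>N. \<forall>m\<ge>N. \<forall>n\<ge>N. dist (x m) (x n) < e" by blast
  qed
  then obtain p where p: "x \<longlonglongrightarrow> p"
    unfolding Cauchy_convergent_iff convergent_def by blast
  have pM: "p \<in> M"
    using assms(2) x(1) p closed_sequentially by blast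
  have "(norm (a - p))\<^sup>2 \<le> d\<^sup>2 + 0"
  proof (rule LIMSEQ_le)
    show "(\<lambda>n. (norm (a - x n))\<^sup>2) \<longlonglongrightarrow> (norm (a - p))\<^sup>2"
      by (intro tendsto_intros p)
    show "(\<lambda>n. d\<^sup>2 + 1 / real (Suc n)) \<longlonglongrightarrow> d\<^sup>2 + 0"
      using LIMSEQ_inverse_real_of_nat by (intro tendsto_intros) (simp add: inverse_eq_divide)
  qed (use x(2) less_imp_le in blast)
  then have pd: "(norm (a - p))\<^sup>2 \<le> d\<^sup>2" by simp
  show ?thesis
  proof (rule that)
    show "a - p \<noteq> 0" using a pM by auto
    fix y assume y: "y \<in> M"
    let ?v = "a - p"
    show "?v \<bullet> y = 0"
    proof (cases "y = 0")
      case False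
      \<comment> \<open>This \<open>c\<close> minimises the distance from \<open>?v\<close> to the
        multiples of \<open>y\<close>. The minimum falls below the squared norm of \<open>?v\<close>
        by \<open>(?v \<bullet> y)\<^sup>2 / (y \<bullet> y)\<close>, while minimality of
        \<open>d\<close> allows no decrease.\<close>
      define c where "c = (?v \<bullet> y) / (y \<bullet> y)"
      have yy: "y \<bullet> y > 0" using False by simp
      have "p + c *\<^sub>R y \<in> M"
        using pM y assms(1) by (intro subspace_add subspace_scale)
      then have "d\<^sup>2 \<le> (norm (a - (p + c *\<^sub>R y)))\<^sup>2"
        using dle d0 by (intro power_mono) auto
      also have "\<dots> = (norm (?v - c *\<^sub>R y))\<^sup>2"
        by (simp add: diff_diff_eq)
      also have "\<dots> = (norm ?v)\<^sup>2 - 2 * c * (?v \<bullet> y) + c\<^sup>2 * (y \<bullet> y)"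
        using dot_norm_neg[of ?v "c *\<^sub>R y"] by (simp add: power_mult_distrib power2_norm_eq_inner)
      also have "\<dots> = (norm ?v)\<^sup>2 - (?v \<bullet> y)\<^sup>2 / (y \<bullet> y)"
        using yy by (simp add: c_def power2_eq_square field_simps)
      finally have "(?v \<bullet> y)\<^sup>2 / (y \<bullet> y) \<le> 0"
        using pd by simp
      then have "(?v \<bullet> y)\<^sup>2 \<le> 0"
        using yy by (simp add: divide_le_0_iff)
      then show ?thesis by simp
    qed simp
  qed
qed

lemma subspace_closure:
  fixes M :: "'a::real_normed_vector set"
  assumes "subspace M"
  shows "subspace (closure M)"
proof (rule subspaceI)
  show "0 \<in> closure M"
    using subspace_0[OF assms] closure_subset by (rule subsetD[rotated])
  fix x y and c :: real assume "x \<in> closure M"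
  then obtain f where f: "\<And>n. f n \<in> M" "f \<longlonglongrightarrow> x"
    unfolding closure_sequential by blast
  show "c *\<^sub>R x \<in> closure M"
    unfolding closure_sequential using f assms
    by (intro exI[of _ "\<lambda>n. c *\<^sub>R f n"] conjI allI tendsto_intros) (auto intro: subspace_scale)
  assume "y \<in> closure M"
  then obtain g where g: "\<And>n. g n \<in> M" "g \<longlonglongrightarrow> y"
    unfolding closure_sequential by blast
  show "x + y \<in> closure M"
    unfolding closure_sequential using f g assms
    by (intro exI[of _ "\<lambda>n. f n + g n"] conjI allI tendsto_intros) (auto intro: subspace_add)
qed

text \<open>Zorn's lemma yields a maximal orthonormal set. If its span were not dense, a unit vector
  orthogonal to the closed span could be added.\<close>

lemma exists_orthonormal_basis:
  obtains B :: "'h::{real_inner,complete_space} set" where "orthonormal_basis B"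
proof -
  let ?P = "{B :: 'h set. pairwise orthogonal B \<and> (\<forall>e\<in>B. norm e = 1)}"
  have "\<Union>C \<in> ?P" if "subset.chain ?P C" for C
    using that unfolding subset_chain_def
    by (intro CollectI conjI pairwise_chain_Union) (auto simp: chain_subset_def)
  moreover have "?P \<noteq> {}"
    by (rule ex_in_conv[THEN iffD1]) (rule exI[of _ "{}"], simp)
  ultimately have "\<exists>B\<in>?P. \<forall>X\<in>?P. B \<subseteq> X \<longrightarrow> X = B"
    by (intro subset_Zorn_nonempty)
  then obtain B where B: "B \<in> ?P" "\<forall>X\<in>?P. B \<subseteq> X \<longrightarrow> X = B"
    by (rule bexE)
  have "closure (span B) = UNIV"
  proof (rule ccontr)
    assume "closure (span B) \<noteq> UNIV"
    then obtain v where v: "v \<noteq> 0" "\<And>x. x \<in> closure (span B) \<Longrightarrow> v \<bullet> x = 0"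
      using exists_orthogonal_closed_subspace[OF subspace_closure[OF subspace_span] closed_closure]
      by blast
    define e where "e = v /\<^sub>R norm v"
    have ne: "norm e = 1" using v(1) by (simp add: e_def)
    have orth: "e \<bullet> b = 0" if "b \<in> B" for b
      using v(2)[OF subsetD[OF closure_subset span_base[OF that]]] by (simp add: e_def)
    have "insert e B \<in> ?P"
      using B(1) ne orth by (auto simp: pairwise_insert orthogonal_def inner_commute)
    from bspec[OF B(2) this] have "insert e B = B"
      by (rule mp) blast
    then have "e \<in> B" by blast
    then have "e \<bullet> e = 0" using orth by blast
    then show False using ne by auto
  qed
  then show ?thesis
    using B(1) by (intro that[of B]) (simp add: orthonormal_basis_def)
qed

text \<open>The difference of the two sides is the squared distance from \<open>v\<close> to its
  projection \<open>?w\<close> onto the span of \<open>F\<close>.\<close>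

lemma Bessel_inequality:
  assumes "finite F" "pairwise orthogonal F" "\<And>e. e \<in> F \<Longrightarrow> norm e = 1"
  shows "(\<Sum>e\<in>F. (v \<bullet> e)\<^sup>2) \<le> (norm v)\<^sup>2"
proof -
  let ?w = "\<Sum>e\<in>F. (v \<bullet> e) *\<^sub>R e"
  have we: "?w \<bullet> e = v \<bullet> e" if "e \<in> F" for e
  proof -
    have "?w \<bullet> e = (\<Sum>e'\<in>F. if e' = e then v \<bullet> e else 0)"
      unfolding inner_sum_left using assms(2,3) that
      by (intro sum.cong) (auto simp: pairwise_def orthogonal_def dot_square_norm)
    then show ?thesis using assms(1) that by simp
  qed
  have ww: "?w \<bullet> ?w = (\<Sum>e\<in>F. (v \<bullet> e)\<^sup>2)"
    using we by (subst inner_sum_right) (simp add: power2_eq_square)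
  have vw: "v \<bullet> ?w = (\<Sum>e\<in>F. (v \<bullet> e)\<^sup>2)"
    by (simp add: inner_sum_right power2_eq_square)
  have "0 \<le> (v - ?w) \<bullet> (v - ?w)" by simp
  also have "\<dots> = (norm v)\<^sup>2 - (\<Sum>e\<in>F. (v \<bullet> e)\<^sup>2)"
    using ww vw by (simp add: inner_diff_left inner_diff_right inner_commute power2_norm_eq_inner)
  finally show ?thesis by simp
qed

section \<open>Traces of positive operators\<close>

lemma adjoint_self_adjoint: "self_adjoint T \<Longrightarrow> adjoint T = T"
  unfolding self_adjoint_def by (intro adjoint_unique) auto

text \<open>A positive self-adjoint \<open>T\<close> is its own absolute value, so \<open>T\<close>
  itself serves as the square root. The diagonal terms are nonnegative, hence a uniform bound on
  finite partial sums gives summability over any orthonormal basis.\<close>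

lemma trace_class_positive:
  fixes T :: "'h::{real_inner,complete_space} \<Rightarrow> 'h"
  assumes "self_adjoint T" "positive_op T"
    and "\<And>F. finite F \<Longrightarrow> pairwise orthogonal F \<Longrightarrow> (\<forall>e\<in>F. norm e = 1) \<Longrightarrow> (\<Sum>e\<in>F. T e \<bullet> e) \<le> C"
  shows "trace_class T"
proof -
  obtain B :: "'h set" where B: "orthonormal_basis B"
    using exists_orthonormal_basis by blast
  have "(\<lambda>e. T e \<bullet> e) summable_on B"
  proof (rule nonneg_bdd_above_summable_on)
    show "0 \<le> T e \<bullet> e" for e
      using assms(2) by (simp add: positive_op_def)
    show "bdd_above (sum (\<lambda>e. T e \<bullet> e) ` {F. F \<subseteq> B \<and> finite F})"
    proof (rule bdd_aboveI2)
      fix F assume "F \<in> {F. F \<subseteq> B \<and> finite F}"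
      then show "(\<Sum>e\<in>F. T e \<bullet> e) \<le> C"
        using B by (intro assms(3)) (auto simp: orthonormal_basis_def intro: pairwise_subset)
    qed
  qed
  moreover have "bounded_linear T" "T \<circ> T = adjoint T \<circ> T"
    using assms(1) adjoint_self_adjoint[OF assms(1)] by (simp_all only: self_adjoint_def)
  ultimately show ?thesis
    unfolding trace_class_def using assms(1,2) B by blast
qed


section \<open>Integrals of rank one operators\<close>

text \<open>The integral lies in the closed span of the rank one operators, and the compact
  operators form a closed subspace containing them.\<close>

lemma has_Bochner_tensor:
  fixes k :: "real \<Rightarrow> 'h::{real_inner,complete_space}"
  assumes fin: "finite_measure M" and sets: "sets M = sets (restrict_space borel {s..t})"
    and k: "continuous_on {s..t} k"
  obtains S where "has_Bochner M (\<lambda>\<tau>. tensor_op (k \<tau>) (k \<tau>)) S" "compact_op (blinfun_apply S)"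
proof (rule has_Bochner_continuous[OF complete_UNIV_blinfun fin sets])
  show "continuous_on {s..t} (\<lambda>\<tau>. tensor_op (k \<tau>) (k \<tau>))"
    by (intro bounded_bilinear.continuous_on[OF bounded_bilinear_tensor_op] k)
next
  fix S
  assume "has_Bochner M (\<lambda>\<tau>. tensor_op (k \<tau>) (k \<tau>)) S"
    and S: "S \<in> closure (span ((\<lambda>\<tau>. tensor_op (k \<tau>) (k \<tau>)) ` {s..t}))"
  moreover have "closure (span ((\<lambda>\<tau>. tensor_op (k \<tau>) (k \<tau>)) ` {s..t}))
      \<subseteq> {S. compact_op (blinfun_apply S)}"
    by (intro closure_minimal span_minimal subspace_compact_op closed_compact_op)
      (auto intro: compact_op_tensor)
  ultimately show thesis
    using that by blast
qed

text \<open>Evaluation at \<open>g\<close> is a bounded linear map on the space of operators, so it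
  commutes with the integral.\<close>

lemma has_Bochner_tensor_apply:
  assumes "has_Bochner M (\<lambda>\<tau>. tensor_op (k \<tau>) (k \<tau>)) S"
  shows "has_Bochner M (\<lambda>\<tau>. (k \<tau> \<bullet> g) *\<^sub>R k \<tau>) (S g)"
  using has_Bochner_bounded_linear[OF blinfun.bounded_linear_left assms] by simp

text \<open>Pairing with \<open>h\<close> is a further bounded linear map and leads to a real
  integral. The integrand is symmetric in \<open>g\<close> and \<open>h\<close> and a square for
  \<open>h = g\<close>, whence self-adjointness and positivity.\<close>

lemma tensor_integral:
  assumes "has_Bochner M (\<lambda>\<tau>. tensor_op (k \<tau>) (k \<tau>)) S"
  shows "integrable M (\<lambda>\<tau>. (k \<tau> \<bullet> g) * (k \<tau> \<bullet> h))"
    and "S g \<bullet> h = (\<integral>\<tau>. (k \<tau> \<bullet> g) * (k \<tau> \<bullet> h) \<partial>M)"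
  using has_Bochner_bounded_linear[OF bounded_linear_inner_left has_Bochner_tensor_apply[OF assms]]
  by (simp_all add: has_Bochner_real_iff)

lemma self_adjoint_tensor_integral:
  assumes "has_Bochner M (\<lambda>\<tau>. tensor_op (k \<tau>) (k \<tau>)) S"
  shows "self_adjoint (blinfun_apply S)"
  unfolding self_adjoint_def
proof (intro conjI allI)
  show "bounded_linear (blinfun_apply S)"
    by (rule blinfun.bounded_linear_right)
  show "S f \<bullet> g = f \<bullet> S g" for f g
    unfolding inner_commute[of f "S g"] tensor_integral(2)[OF assms] by (simp only: mult.commute)
qed

lemma positive_op_tensor_integral:
  assumes "has_Bochner M (\<lambda>\<tau>. tensor_op (k \<tau>) (k \<tau>)) S"
  shows "positive_op (blinfun_apply S)"
  unfolding positive_op_def tensor_integral(2)[OF assms] by (intro allI integral_nonneg) simp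

text \<open>Under the integral, Bessel's inequality bounds each partial trace by the integral of
  \<open>c\<^sup>2\<close>, which is finite and independent of \<open>F\<close>.\<close>

lemma trace_class_tensor_integral:
  fixes k :: "'a \<Rightarrow> 'h::{real_inner,complete_space}"
  assumes S: "has_Bochner M (\<lambda>\<tau>. tensor_op (k \<tau>) (k \<tau>)) S"
    and fin: "finite_measure M" and c: "\<And>\<tau>. norm (k \<tau>) \<le> c"
  shows "trace_class (blinfun_apply S)"
proof (rule trace_class_positive[OF self_adjoint_tensor_integral[OF S] positive_op_tensor_integral[OF S]])
  fix F :: "'h set" assume F: "finite F" "pairwise orthogonal F" "\<forall>e\<in>F. norm e = 1"
  have "(\<Sum>e\<in>F. S e \<bullet> e) = (\<integral>\<tau>. (\<Sum>e\<in>F. (k \<tau> \<bullet> e)\<^sup>2) \<partial>M)"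
    unfolding tensor_integral(2)[OF S] power2_eq_square
    by (intro Bochner_Integration.integral_sum[symmetric] tensor_integral(1)[OF S])
  also have "\<dots> \<le> (\<integral>\<tau>. c\<^sup>2 \<partial>M)"
  proof (rule integral_mono)
    show "integrable M (\<lambda>\<tau>. \<Sum>e\<in>F. (k \<tau> \<bullet> e)\<^sup>2)"
      unfolding power2_eq_square
      by (intro Bochner_Integration.integrable_sum tensor_integral(1)[OF S])
    show "(\<Sum>e\<in>F. (k \<tau> \<bullet> e)\<^sup>2) \<le> c\<^sup>2" for \<tau>
      using F by (intro order_trans[OF Bessel_inequality power_mono[OF c]]) auto
  qed (simp add: finite_measure.integrable_const[OF fin])
  finally show "(\<Sum>e\<in>F. S e \<bullet> e) \<le> (\<integral>\<tau>. c\<^sup>2 \<partial>M)" .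
qed


section \<open>The operator along a trajectory\<close>

lemma inner_kernel_at:
  assumes "native_space K \<iota>"
  shows "kernel_at \<iota> K x \<bullet> kernel_at \<iota> K y = K y x"
proof -
  have "kernel_at \<iota> K x \<bullet> kernel_at \<iota> K y = \<iota> (kernel_at \<iota> K y) x"
    using assms by (simp add: native_space_def)
  then show ?thesis
    by (simp add: kernel_at_apply[OF assms])
qed

text \<open>The reproducing property expresses the distance between two kernel sections through four
  values of \<open>K\<close>, so continuity of \<open>K\<close> gives continuity in norm.\<close>

lemma continuous_on_kernel_at:
  fixes K :: "'x::topological_space \<Rightarrow> 'x \<Rightarrow> real"
  assumes K: "continuous_on UNIV (\<lambda>(x, y). K x y)" and ns: "native_space K \<iota>"
  shows "continuous_on UNIV (kernel_at \<iota> K)"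
proof -
  let ?k = "kernel_at \<iota> K"
  have "(?k \<longlongrightarrow> ?k x) (at x)" for x
  proof -
    have cont: "continuous_on UNIV (\<lambda>y. K (p y) (q y))"
      if "continuous_on UNIV p" "continuous_on UNIV q" for p q :: "'x \<Rightarrow> 'x"
      using continuous_on_compose2[OF K continuous_on_Pair[OF that]] by simp
    have "continuous_on UNIV (\<lambda>y. sqrt (K y y - K x y - K y x + K x x))"
      by (intro continuous_intros cont)
    moreover have "norm (?k y - ?k x) = sqrt (K y y - K x y - K y x + K x x)" for y
      by (simp add: norm_eq_sqrt_inner inner_diff_left inner_diff_right inner_kernel_at[OF ns])
    ultimately have "continuous_on UNIV (\<lambda>y. norm (?k y - ?k x))"
      by simp
    then have "((\<lambda>y. norm (?k y - ?k x)) \<longlongrightarrow> norm (?k x - ?k x)) (at x)"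
      unfolding continuous_on_def by blast
    then show ?thesis
      by (simp add: tendsto_norm_zero_iff LIM_zero_iff)
  qed
  then show ?thesis
    by (simp add: continuous_on_def)
qed

lemma eval_adj_eval_op:
  assumes "native_space K \<iota>"
  shows "eval_adj \<iota> x (eval_op \<iota> x g) = (kernel_at \<iota> K x \<bullet> g) *\<^sub>R kernel_at \<iota> K x"
  unfolding eval_adj_apply[OF assms] eval_op_apply[OF assms]
  using assms by (simp add: native_space_def)

lemma eval_adj_comp_eval_op:
  assumes "native_space K \<iota>"
  shows "eval_adj \<iota> x o\<^sub>L eval_op \<iota> x = tensor_op (kernel_at \<iota> K x) (kernel_at \<iota> K x)"
  by (rule blinfun_eqI) (simp add: eval_adj_eval_op[OF assms])

text \<open>The integral in the operator space, evaluated at \<open>g\<close>, is an integral of the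
  vectors that define \<open>T_op\<close>; uniqueness identifies the two.\<close>

lemma T_op_eq:
  assumes "native_space K \<iota>"
    and "has_Bochner \<nu> (\<lambda>\<tau>. tensor_op (kernel_at \<iota> K (\<phi> \<tau>)) (kernel_at \<iota> K (\<phi> \<tau>))) S"
  shows "T_op \<iota> \<phi> \<nu> = blinfun_apply S"
  unfolding T_op_def eval_adj_eval_op[OF assms(1)]
  by (intro ext Bochner_eqI has_Bochner_tensor_apply[OF assms(2)])

text \<open>Evaluation at \<xi> is the inner product with the kernel section at \<xi>, so the value
  sought is a matrix entry of \<open>S\<close>.\<close>

lemma T_op_apply:
  assumes "native_space K \<iota>"
    and "has_Bochner \<nu> (\<lambda>\<tau>. tensor_op (kernel_at \<iota> K (\<phi> \<tau>)) (kernel_at \<iota> K (\<phi> \<tau>))) S"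
  shows "integrable \<nu> (\<lambda>\<tau>. K \<xi> (\<phi> \<tau>) * (kernel_at \<iota> K (\<phi> \<tau>) \<bullet> g))"
    and "\<iota> (T_op \<iota> \<phi> \<nu> g) \<xi> = (\<integral>\<tau>. K \<xi> (\<phi> \<tau>) * (kernel_at \<iota> K (\<phi> \<tau>) \<bullet> g) \<partial>\<nu>)"
proof -
  let ?k = "kernel_at \<iota> K"
  have K: "K \<xi> (\<phi> \<tau>) * (?k (\<phi> \<tau>) \<bullet> g) = (?k (\<phi> \<tau>) \<bullet> g) * (?k (\<phi> \<tau>) \<bullet> ?k \<xi>)" for \<tau>
    by (simp add: inner_kernel_at[OF assms(1)])
  show "integrable \<nu> (\<lambda>\<tau>. K \<xi> (\<phi> \<tau>) * (?k (\<phi> \<tau>) \<bullet> g))"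
    unfolding K by (rule tensor_integral(1)[OF assms(2)])
  have "\<iota> (T_op \<iota> \<phi> \<nu> g) \<xi> = S g \<bullet> ?k \<xi>"
    using assms(1) by (simp add: native_space_def T_op_eq[OF assms] inner_commute)
  then show "\<iota> (T_op \<iota> \<phi> \<nu> g) \<xi> = (\<integral>\<tau>. K \<xi> (\<phi> \<tau>) * (?k (\<phi> \<tau>) \<bullet> g) \<partial>\<nu>)"
    unfolding K tensor_integral(2)[OF assms(2)] .
qed

theorem theorem1:
  fixes K :: "'x::complete_space \<Rightarrow> 'x \<Rightarrow> real"
    and \<iota> :: "'h::{real_inner,complete_space} \<Rightarrow> 'x \<Rightarrow> real"
    and s t :: real
    and \<nu> :: "real measure"
    and \<phi> :: "real \<Rightarrow> 'x"
  assumes "admissible_kernel K"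
    and "continuous_on UNIV (\<lambda>(x, y). K x y)"
    and "native_space K \<iota>"
    and "0 \<le> s" and "s \<le> t"
    and "finite_measure \<nu>"
    and "sets \<nu> = sets (restrict_space borel {s..t})"
    and "continuous_on {0..t} \<phi>"
  shows
    "(\<forall>g. Bochner_integrable \<nu> (\<lambda>\<tau>. eval_adj \<iota> (\<phi> \<tau>) (eval_op \<iota> (\<phi> \<tau>) g))) \<and>
     (\<forall>g \<xi>.
        integrable \<nu> (\<lambda>\<tau>. K \<xi> (\<phi> \<tau>) * (kernel_at \<iota> K (\<phi> \<tau>) \<bullet> g)) \<and>
        integrable \<nu> (\<lambda>\<tau>. K \<xi> (\<phi> \<tau>) * \<iota> g (\<phi> \<tau>)) \<and>
        \<iota> (T_op \<iota> \<phi> \<nu> g) \<xi> = (\<integral>\<tau>. K \<xi> (\<phi> \<tau>) * (kernel_at \<iota> K (\<phi> \<tau>) \<bullet> g) \<partial>\<nu>) \<and>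
        \<iota> (T_op \<iota> \<phi> \<nu> g) \<xi> = (\<integral>\<tau>. K \<xi> (\<phi> \<tau>) * \<iota> g (\<phi> \<tau>) \<partial>\<nu>)) \<and>
     ((\<exists>Kbar>0. \<forall>x. sqrt (K x x) \<le> Kbar) \<longrightarrow>
        (continuous_on {s..t} (\<lambda>\<tau>. tensor_op (kernel_at \<iota> K (\<phi> \<tau>)) (kernel_at \<iota> K (\<phi> \<tau>))) \<and>
         (\<lambda>\<tau>. tensor_op (kernel_at \<iota> K (\<phi> \<tau>)) (kernel_at \<iota> K (\<phi> \<tau>)))
           \<in> restrict_space borel {s..t} \<rightarrow>\<^sub>M borel) \<and>
        (Bochner_integrable \<nu> (\<lambda>\<tau>. tensor_op (kernel_at \<iota> K (\<phi> \<tau>)) (kernel_at \<iota> K (\<phi> \<tau>))) \<and>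
         Bochner_integrable \<nu> (\<lambda>\<tau>. eval_adj \<iota> (\<phi> \<tau>) o\<^sub>L eval_op \<iota> (\<phi> \<tau>)) \<and>
         T_op \<iota> \<phi> \<nu> =
           blinfun_apply
             (Bochner \<nu> (\<lambda>\<tau>. tensor_op (kernel_at \<iota> K (\<phi> \<tau>)) (kernel_at \<iota> K (\<phi> \<tau>)))) \<and>
         T_op \<iota> \<phi> \<nu> =
           blinfun_apply (Bochner \<nu> (\<lambda>\<tau>. eval_adj \<iota> (\<phi> \<tau>) o\<^sub>L eval_op \<iota> (\<phi> \<tau>)))) \<and>
        (compact_op (T_op \<iota> \<phi> \<nu>) \<and> self_adjoint (T_op \<iota> \<phi> \<nu>) \<and>
         positive_op (T_op \<iota> \<phi> \<nu>) \<and> trace_class (T_op \<iota> \<phi> \<nu>)))"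
proof -
  let ?k = "\<lambda>\<tau>. kernel_at \<iota> K (\<phi> \<tau>)"
  let ?R = "\<lambda>\<tau>. tensor_op (?k \<tau>) (?k \<tau>)"
  note ns = assms(3)
  have "continuous_on {s..t} \<phi>"
    using assms(8) by (rule continuous_on_subset) (use assms(4) in auto)
  then have k: "continuous_on {s..t} ?k"
    using continuous_on_compose2[OF continuous_on_kernel_at[OF assms(2) ns]] by blast
  \<comment> \<open>All remaining claims are read off this single operator, since
    \<open>T_op\<close> and both operator-valued integrals equal \<open>S\<close>.\<close>
  obtain S where S: "has_Bochner \<nu> ?R S" "compact_op (blinfun_apply S)"
    by (rule has_Bochner_tensor[OF assms(6,7) k])
  have T: "T_op \<iota> \<phi> \<nu> = blinfun_apply S"
    by (rule T_op_eq[OF ns S(1)])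
  have R: "continuous_on {s..t} ?R"
    by (intro bounded_bilinear.continuous_on[OF bounded_bilinear_tensor_op] k)
  have B: "Bochner \<nu> ?R = S"
    by (rule Bochner_eqI[OF S(1)])
  have CC: "(\<lambda>\<tau>. eval_adj \<iota> (\<phi> \<tau>) o\<^sub>L eval_op \<iota> (\<phi> \<tau>)) = ?R"
    by (intro ext eval_adj_comp_eval_op[OF ns])
  have \<iota>: "\<iota> g (\<phi> \<tau>) = ?k \<tau> \<bullet> g" for g \<tau>
    using ns by (simp add: native_space_def)
  show ?thesis
  proof (intro conjI allI impI)
    fix g \<xi>
    show "Bochner_integrable \<nu> (\<lambda>\<tau>. eval_adj \<iota> (\<phi> \<tau>) (eval_op \<iota> (\<phi> \<tau>) g))"
      unfolding eval_adj_eval_op[OF ns] Bochner_integrable_def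
      by (rule exI, rule has_Bochner_tensor_apply[OF S(1)])
    show int: "integrable \<nu> (\<lambda>\<tau>. K \<xi> (\<phi> \<tau>) * (?k \<tau> \<bullet> g))"
      and eq: "\<iota> (T_op \<iota> \<phi> \<nu> g) \<xi> = (\<integral>\<tau>. K \<xi> (\<phi> \<tau>) * (?k \<tau> \<bullet> g) \<partial>\<nu>)"
      by (rule T_op_apply[OF ns S(1)])+
    show "integrable \<nu> (\<lambda>\<tau>. K \<xi> (\<phi> \<tau>) * \<iota> g (\<phi> \<tau>))"
      unfolding \<iota> by (rule int)
    show "\<iota> (T_op \<iota> \<phi> \<nu> g) \<xi> = (\<integral>\<tau>. K \<xi> (\<phi> \<tau>) * \<iota> g (\<phi> \<tau>) \<partial>\<nu>)"
      unfolding \<iota> by (rule eq)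
  next
    show "continuous_on {s..t} ?R"
      by (rule R)
    then show "?R \<in> restrict_space borel {s..t} \<rightarrow>\<^sub>M borel"
      by (rule borel_measurable_continuous_on_restrict)
    show R: "Bochner_integrable \<nu> ?R"
      unfolding Bochner_integrable_def by (rule exI, rule S(1))
    show "Bochner_integrable \<nu> (\<lambda>\<tau>. eval_adj \<iota> (\<phi> \<tau>) o\<^sub>L eval_op \<iota> (\<phi> \<tau>))"
      unfolding CC by (rule R)
    show "T_op \<iota> \<phi> \<nu> = blinfun_apply (Bochner \<nu> ?R)"
      "T_op \<iota> \<phi> \<nu> = blinfun_apply (Bochner \<nu> (\<lambda>\<tau>. eval_adj \<iota> (\<phi> \<tau>) o\<^sub>L eval_op \<iota> (\<phi> \<tau>)))"
      unfolding CC B by (rule T)+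
    show "compact_op (T_op \<iota> \<phi> \<nu>)" "self_adjoint (T_op \<iota> \<phi> \<nu>)" "positive_op (T_op \<iota> \<phi> \<nu>)"
      unfolding T
      by (rule S(2) self_adjoint_tensor_integral[OF S(1)] positive_op_tensor_integral[OF S(1)])+
    assume "\<exists>Kbar>0. \<forall>x. sqrt (K x x) \<le> Kbar"
    \<comment> \<open>The norm of the kernel section at \<open>x\<close> is the square root of
      \<open>K x x\<close>, so the bound on the diagonal bounds the curve uniformly.\<close>
    then obtain c where "norm (?k \<tau>) \<le> c" for \<tau>
      by (auto simp: norm_eq_sqrt_inner inner_kernel_at[OF ns])
    then show "trace_class (T_op \<iota> \<phi> \<nu>)"
      unfolding T by (rule trace_class_tensor_integral[OF S(1) assms(6)])
  qed
qed

end
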